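(* Let $A, X \subseteq \omega$ be arbitrary sets. Suppose that for each $\epsilon > 0$ there is a set $D_\epsilon \subseteq \omega$ such that $\overline{\rho}(X \triangle D_\epsilon) \leq \epsilon$ and $A \not\leq_{\mathrm T} D_\epsilon$. Then there is a coarse description $D$ of $X$ such that $A \not\leq_{\mathrm T} D$.
   Context: For $B \subseteq \omega$ and $n \geq 1$ let $\rho_n(B) = |B \cap [0,n)|/n$; the upper density is $\overline{\rho}(B) = \limsup_n \rho_n(B)$, and the density $\rho(B)$ is $\lim_n \rho_n(B)$ when it exists. $D$ is a coarse description of $X$ if $\rho(D \triangle X) = 0$, where $\triangle$ is symmetric difference. $\leq_{\mathrm T}$ is Turing reducibility. *)

theory Defs
  imports "HOL-Library.Extended_Real"
begin

section \<open>Density\<close>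

text \<open>The value at \<open>n = 0\<close> is \<open>0\<close> by the convention for division; it does not affect limits.\<close>

definition partial_density :: "nat \<Rightarrow> nat set \<Rightarrow> real" where
  "partial_density n B = real (card (B \<inter> {0..<n})) / real n"

definition upper_density :: "nat set \<Rightarrow> ereal" where
  "upper_density B = limsup (\<lambda>n. ereal (partial_density n B))"

definition has_density :: "nat set \<Rightarrow> real \<Rightarrow> bool" where
  "has_density B d \<longleftrightarrow> (\<lambda>n. partial_density n B) \<longlonglongrightarrow> d"

definition coarse_description :: "nat set \<Rightarrow> nat set \<Rightarrow> bool" where
  "coarse_description D X \<longleftrightarrow> has_density (sym_diff D X) 0"

section \<open>Turing reducibility\<close>

text \<open>
  Oracle computation is given by Kleene's schemes for functions partial recursive in an oracle:
  \<open>Query\<close> is the characteristic function of the oracle, \<open>Comp\<close> is composition, \<open>PrimRec\<close> is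
  primitive recursion on the first argument, and \<open>Mu\<close> is unbounded minimization over the first
  argument. A program does not have a fixed arity; it is undefined on argument lists of
  unsuitable length, and \<open>Zero\<close> is the constant function of every arity.
\<close>

datatype oprog =
    Zero
  | Succ
  | Proj nat
  | Query
  | Comp oprog "oprog list"
  | PrimRec oprog oprog
  | Mu oprog

text \<open>
  \<open>oeval B p xs y\<close> means that \<open>p\<close> with oracle \<open>B\<close> halts on input \<open>xs\<close> with output \<open>y\<close>.
  In the rule for \<open>Mu\<close>, all values below the result must be defined and nonzero.
\<close>

inductive oeval :: "nat set \<Rightarrow> oprog \<Rightarrow> nat list \<Rightarrow> nat \<Rightarrow> bool" for B where
  oeval_Zero: "oeval B Zero xs 0"
| oeval_Succ: "oeval B Succ [x] (Suc x)"
| oeval_Proj: "i < length xs \<Longrightarrow> oeval B (Proj i) xs (xs ! i)"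
| oeval_Query: "oeval B Query [x] (of_bool (x \<in> B))"
| oeval_Comp: "list_all2 (\<lambda>g y. oeval B g xs y) gs ys \<Longrightarrow> oeval B f ys z
    \<Longrightarrow> oeval B (Comp f gs) xs z"
| oeval_PrimRec_0: "oeval B f xs y \<Longrightarrow> oeval B (PrimRec f g) (0 # xs) y"
| oeval_PrimRec_Suc: "oeval B (PrimRec f g) (n # xs) r \<Longrightarrow> oeval B g (n # r # xs) y
    \<Longrightarrow> oeval B (PrimRec f g) (Suc n # xs) y"
| oeval_Mu: "oeval B f (z # xs) 0 \<Longrightarrow> (\<And>y. y < z \<Longrightarrow> \<exists>v. oeval B f (y # xs) (Suc v))
    \<Longrightarrow> oeval B (Mu f) xs z"

inductive_cases oeval_elims:
  "oeval B Zero xs y" "oeval B Succ xs y" "oeval B (Proj i) xs y" "oeval B Query xs y"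
  "oeval B (Comp f gs) xs y" "oeval B (PrimRec f g) (0 # xs) y"
  "oeval B (PrimRec f g) (Suc n # xs) y" "oeval B (Mu f) xs y"

lemma oeval_deterministic: "oeval B p xs y \<Longrightarrow> oeval B p xs y' \<Longrightarrow> y = y'"
proof (induction arbitrary: y' rule: oeval.induct)
  case (oeval_Comp xs gs ys f z)
  from oeval_Comp.prems obtain ys' where
    ys': "list_all2 (\<lambda>g y. oeval B g xs y) gs ys'" "oeval B f ys' y'"
    by (rule oeval_elims)
  have "ys = ys'"
  proof (rule nth_equalityI)
    show "length ys = length ys'"
      using oeval_Comp.IH(1) ys'(1) by (simp add: list_all2_conv_all_nth)
    show "ys ! i = ys' ! i" if "i < length ys" for i
      using that oeval_Comp.IH(1) ys'(1) by (simp add: list_all2_conv_all_nth)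
  qed
  then show ?case
    using oeval_Comp.IH(2) ys'(2) by blast
next
  case (oeval_PrimRec_0 f xs y g)
  from oeval_PrimRec_0.prems have "oeval B f xs y'" by (rule oeval_elims)
  then show ?case by (rule oeval_PrimRec_0.IH)
next
  case (oeval_PrimRec_Suc f g n xs r y)
  from oeval_PrimRec_Suc.prems obtain r' where
    r': "oeval B (PrimRec f g) (n # xs) r'" "oeval B g (n # r' # xs) y'"
    by (rule oeval_elims)
  from r'(1) have "r = r'" by (rule oeval_PrimRec_Suc.IH)
  with r'(2) show ?case using oeval_PrimRec_Suc.IH(2) by blast
next
  case (oeval_Mu f z xs)
  from oeval_Mu.prems have y': "oeval B f (y' # xs) 0"
    "\<forall>y<y'. \<exists>v. oeval B f (y # xs) (Suc v)"
    by (auto elim: oeval_elims(8))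
  have "\<not> y' < z"
  proof
    assume "y' < z"
    then obtain v where "\<And>w. oeval B f (y' # xs) w \<Longrightarrow> Suc v = w"
      using oeval_Mu.IH(2) by blast
    with y'(1) show False by blast
  qed
  moreover have "\<not> z < y'"
  proof
    assume "z < y'"
    then obtain v where "oeval B f (z # xs) (Suc v)" using y'(2) by blast
    then have "0 = Suc v" by (rule oeval_Mu.IH(1))
    then show False by simp
  qed
  ultimately show ?case by simp
qed (auto elim: oeval_elims(1-4))

definition turing_reducible :: "nat set \<Rightarrow> nat set \<Rightarrow> bool"  (infix \<open>\<le>\<^sub>T\<close> 50) where
  "A \<le>\<^sub>T B \<longleftrightarrow> (\<exists>p. \<forall>n. oeval B p [n] (of_bool (n \<in> A)))"

end

(*
  D is built by finite extension. Stage i starts from a finite string whose disagreement with X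
  is at most 4^-i on its length; from then on D may deviate from X on any initial segment of
  length m in at most 4^-i m places. The stage defeats the i-th program p as follows. If some
  admissible extension makes p give a wrong value of A, take it. Otherwise suppose that, at every
  argument, p still converges along some extension obeying the sharper bound 4^-(i+1). Let E be a
  set that does not compute A and whose upper density distance from X is tiny. The strings within
  4^-i / 2 of E are admissible and include all the strings obeying the sharper bound, so searching
  for one of them on which p converges would compute A from E. This is absurd, so at some argument
  p diverges along every extension obeying the sharper bound, and passing to that bound defeats p.
*)

theory Submission
  imports Defs "HOL-Library.Countable"
begin

section \<open>Total computable functions\<close>

text \<open>Lists of the fixed length \<open>k\<close> stand for \<open>k\<close> arguments; nothing
  is demanded at other lengths, where a program may diverge.\<close>

definition computable :: "nat set \<Rightarrow> nat \<Rightarrow> (nat list \<Rightarrow> nat) \<Rightarrow> bool" where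
  "computable D k f \<longleftrightarrow> (\<exists>p. \<forall>xs. length xs = k \<longrightarrow> oeval D p xs (f xs))"

definition decidable :: "nat set \<Rightarrow> nat \<Rightarrow> (nat list \<Rightarrow> bool) \<Rightarrow> bool" where
  "decidable D k P \<longleftrightarrow> computable D k (\<lambda>xs. of_bool (P xs))"

lemma computable_cong:
  assumes "computable D k f" "\<And>xs. length xs = k \<Longrightarrow> f xs = g xs"
  shows "computable D k g"
  using assms unfolding computable_def by metis

lemma computable_comp:
  assumes f: "computable D (length gs) f" and gs: "\<And>g. g \<in> set gs \<Longrightarrow> computable D k g"
  shows "computable D k (\<lambda>xs. f (map (\<lambda>g. g xs) gs))"
proof -
  obtain pf where pf: "\<And>ys. length ys = length gs \<Longrightarrow> oeval D pf ys (f ys)"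
    using f unfolding computable_def by blast
  obtain q where q: "\<And>g xs. g \<in> set gs \<Longrightarrow> length xs = k \<Longrightarrow> oeval D (q g) xs (g xs)"
    using gs unfolding computable_def by metis
  have "oeval D (Comp pf (map q gs)) xs (f (map (\<lambda>g. g xs) gs))" if "length xs = k" for xs
    using that
    by (intro oeval_Comp[where ys = "map (\<lambda>g. g xs) gs"] pf)
       (auto simp: list_all2_conv_all_nth intro: q)
  then show ?thesis unfolding computable_def by blast
qed

lemma computable_zero: "computable D k (\<lambda>_. 0)"
  unfolding computable_def by (blast intro: oeval_Zero)

lemma computable_nth: "i < k \<Longrightarrow> computable D k (\<lambda>xs. xs ! i)"
  unfolding computable_def by (blast intro: oeval_Proj)

lemma computable_comp1:
  assumes "computable D 1 (\<lambda>xs. h (hd xs))" "computable D k f"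
  shows "computable D k (\<lambda>xs. h (f xs))"
  using computable_comp[of D "[f]" "\<lambda>xs. h (hd xs)" k] assms by simp

lemma computable_Suc:
  assumes "computable D k f"
  shows "computable D k (\<lambda>xs. Suc (f xs))"
proof (rule computable_comp1[OF _ assms])
  have "oeval D Succ xs (Suc (hd xs))" if "length xs = 1" for xs
    using that by (cases xs) (auto intro: oeval_Succ)
  then show "computable D 1 (\<lambda>xs. Suc (hd xs))" unfolding computable_def by blast
qed

lemma decidable_oracle:
  assumes "computable D k f"
  shows "decidable D k (\<lambda>xs. f xs \<in> D)"
  unfolding decidable_def
proof (rule computable_comp1[OF _ assms])
  have "oeval D Query xs (of_bool (hd xs \<in> D))" if "length xs = 1" for xs
    using that oeval_Query[of D "hd xs"] by (cases xs) auto
  then show "computable D 1 (\<lambda>xs. of_bool (hd xs \<in> D))" unfolding computable_def by blast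
qed

lemma computable_const: "computable D k (\<lambda>_. c)"
  by (induction c) (auto intro: computable_zero computable_Suc)

lemma computable_hd: "computable D (Suc k) hd"
  by (rule computable_cong[OF computable_nth[of 0]]) (auto simp: length_Suc_conv)

text \<open>Ignoring a fresh first argument is composition with the last \<open>k\<close>
  projections. Recursion and minimization act on the first argument, so parameters reach their
  bodies in this form.\<close>

lemma computable_tl:
  assumes "computable D k g"
  shows "computable D (Suc k) (\<lambda>ys. g (tl ys))"
proof -
  let ?gs = "map (\<lambda>i ys. ys ! Suc i) [0..<k]"
  have "computable D (Suc k) (\<lambda>ys. g (map (\<lambda>h. h ys) ?gs))"
    using assms by (intro computable_comp) (auto intro: computable_nth)
  moreover have "map (\<lambda>h. h ys) ?gs = tl ys" if "length ys = Suc k" for ys :: "nat list"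
    using that by (intro nth_equalityI) (auto simp: nth_tl)
  ultimately show ?thesis by (elim computable_cong) (simp only:)
qed

lemma computable_hd_tl: "computable D (Suc (Suc k)) (\<lambda>ys. hd (tl ys))"
  by (intro computable_tl computable_hd)

text \<open>Composition with \<open>b\<close> followed by all \<open>k\<close> projections fills the
  first argument.\<close>

lemma computable_subst:
  assumes f: "computable D (Suc k) (\<lambda>ys. f (hd ys) (tl ys))" and b: "computable D k b"
  shows "computable D k (\<lambda>xs. f (b xs) xs)"
proof -
  let ?gs = "b # map (\<lambda>i ys. ys ! i) [0..<k]"
  have "computable D k (\<lambda>xs. (\<lambda>ys. f (hd ys) (tl ys)) (map (\<lambda>h. h xs) ?gs))"
    using assms by (intro computable_comp) (auto intro: computable_nth)
  moreover have "map (\<lambda>h. h xs) (map (\<lambda>i ys. ys ! i) [0..<k]) = xs" if "length xs = k" for xs :: "nat list"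
    using that by (intro nth_equalityI) auto
  ultimately show ?thesis by (elim computable_cong) (simp only: list.map list.sel)
qed

lemma computable_rec:
  assumes f: "computable D k f"
    and g: "computable D (Suc (Suc k)) (\<lambda>ys. g (hd ys) (hd (tl ys)) (tl (tl ys)))"
    and b: "computable D k b"
  shows "computable D k (\<lambda>xs. rec_nat (f xs) (\<lambda>n r. g n r xs) (b xs))"
proof (rule computable_subst[where f = "\<lambda>m xs. rec_nat (f xs) (\<lambda>n r. g n r xs) m", OF _ b])
  obtain pf where pf: "\<And>xs. length xs = k \<Longrightarrow> oeval D pf xs (f xs)"
    using f unfolding computable_def by blast
  obtain pg where pg: "\<And>xs. length xs = Suc (Suc k) \<Longrightarrow>
      oeval D pg xs (g (hd xs) (hd (tl xs)) (tl (tl xs)))"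
    using g unfolding computable_def by blast
  have rec: "oeval D (PrimRec pf pg) (m # xs) (rec_nat (f xs) (\<lambda>n r. g n r xs) m)"
    if "length xs = k" for m xs
  proof (induction m)
    case 0
    then show ?case using pf that by (auto intro: oeval_PrimRec_0)
  next
    case (Suc m)
    then show ?case
      using oeval_PrimRec_Suc[OF Suc] pg[of "m # rec_nat (f xs) (\<lambda>n r. g n r xs) m # xs"] that
      by auto
  qed
  have "oeval D (PrimRec pf pg) ys (rec_nat (f (tl ys)) (\<lambda>n r. g n r (tl ys)) (hd ys))"
    if "length ys = Suc k" for ys
    using rec[of "tl ys" "hd ys"] that by (cases ys) auto
  then show "computable D (Suc k)
      (\<lambda>ys. rec_nat (f (tl ys)) (\<lambda>n r. g n r (tl ys)) (hd ys))"
    unfolding computable_def by blast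
qed

text \<open>The existence hypothesis makes the search of \<open>Mu\<close> stop, and totality of
  \<open>f\<close> makes every value before the first zero defined and nonzero.\<close>

lemma computable_Least_zero:
  assumes f: "computable D (Suc k) (\<lambda>ys. f (hd ys) (tl ys))"
    and ex: "\<And>xs. length xs = k \<Longrightarrow> \<exists>z. f z xs = 0"
  shows "computable D k (\<lambda>xs. LEAST z. f z xs = 0)"
proof -
  obtain p where p: "\<And>ys. length ys = Suc k \<Longrightarrow> oeval D p ys (f (hd ys) (tl ys))"
    using f unfolding computable_def by blast
  have "oeval D (Mu p) xs (LEAST z. f z xs = 0)" if "length xs = k" for xs
  proof (rule oeval_Mu)
    have 0: "f (LEAST z. f z xs = 0) xs = 0"
      using ex[OF that] by (rule LeastI_ex)
    show "oeval D p ((LEAST z. f z xs = 0) # xs) 0"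
      using p[of "(LEAST z. f z xs = 0) # xs"] that 0 by simp
    show "\<exists>v. oeval D p (y # xs) (Suc v)" if "y < (LEAST z. f z xs = 0)" for y
      using p[of "y # xs"] not_less_Least[OF that] \<open>length xs = k\<close>
      by (metis length_Cons list.sel(1) list.sel(3) not0_implies_Suc)
  qed
  then show ?thesis unfolding computable_def by blast
qed

section \<open>Arithmetic, decidable relations and bounded quantifiers\<close>

lemma computable_add:
  assumes "computable D k f" "computable D k g"
  shows "computable D k (\<lambda>xs. f xs + g xs)"
proof -
  have "rec_nat a (\<lambda>_ r. Suc r) b = a + b" for a b by (induction b) auto
  then show ?thesis
    using computable_rec[OF assms(1) computable_Suc[OF computable_hd_tl] assms(2)] by simp
qed

lemma computable_mult:
  assumes "computable D k f" "computable D k g"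
  shows "computable D k (\<lambda>xs. f xs * g xs)"
proof -
  have "rec_nat 0 (\<lambda>_ r. r + a) b = a * b" for a b :: nat by (induction b) auto
  then show ?thesis
    using computable_rec[OF computable_zero
      computable_add[OF computable_hd_tl computable_tl[OF computable_tl[OF assms(1)]]] assms(2)]
    by simp
qed

lemma computable_pred:
  assumes "computable D k f"
  shows "computable D k (\<lambda>xs. f xs - 1)"
proof -
  have "rec_nat 0 (\<lambda>n _. n) b = b - 1" for b :: nat by (cases b) auto
  then show ?thesis
    using computable_rec[OF computable_zero computable_hd assms] by simp
qed

lemma computable_diff:
  assumes "computable D k f" "computable D k g"
  shows "computable D k (\<lambda>xs. f xs - g xs)"
proof -
  have "rec_nat a (\<lambda>_ r. r - 1) b = a - b" for a b :: nat by (induction b) auto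
  then show ?thesis
    using computable_rec[OF assms(1) computable_pred[OF computable_hd_tl] assms(2)] by simp
qed

text \<open>This is recursion on the truth value: 0 returns the base \<open>g\<close>, and 1
  performs a single step, which discards the previous value and returns \<open>f\<close>.\<close>

lemma computable_if:
  assumes "decidable D k P" "computable D k f" "computable D k g"
  shows "computable D k (\<lambda>xs. if P xs then f xs else g xs)"
proof (rule computable_cong[OF computable_rec[OF assms(3)
        computable_tl[OF computable_tl[OF assms(2)]] assms(1)[unfolded decidable_def]]])
qed simp

text \<open>With truncated subtraction the truth value is \<open>1 - (f xs - g xs)\<close>.\<close>

lemma decidable_le:
  assumes "computable D k f" "computable D k g"
  shows "decidable D k (\<lambda>xs. f xs \<le> g xs)"
  unfolding decidable_def
  by (rule computable_cong[OF computable_diff[OF computable_const[of _ _ 1]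
        computable_diff[OF assms]]]) auto

lemma decidable_not:
  assumes "decidable D k P"
  shows "decidable D k (\<lambda>xs. \<not> P xs)"
  unfolding decidable_def
  by (rule computable_cong[OF computable_if[OF assms computable_const[of _ _ 0]
        computable_const[of _ _ 1]]]) simp

lemma decidable_conj:
  assumes "decidable D k P" "decidable D k Q"
  shows "decidable D k (\<lambda>xs. P xs \<and> Q xs)"
  unfolding decidable_def
  by (rule computable_cong[OF computable_if[OF assms(1) assms(2)[unfolded decidable_def]
        computable_const[of _ _ 0]]]) simp

lemma decidable_disj:
  assumes "decidable D k P" "decidable D k Q"
  shows "decidable D k (\<lambda>xs. P xs \<or> Q xs)"
  using decidable_not[OF decidable_conj[OF assms[THEN decidable_not]]] by simp

lemma decidable_imp:
  assumes "decidable D k P" "decidable D k Q"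
  shows "decidable D k (\<lambda>xs. P xs \<longrightarrow> Q xs)"
  using decidable_disj[OF decidable_not[OF assms(1)] assms(2)] by simp

lemma decidable_less:
  assumes "computable D k f" "computable D k g"
  shows "decidable D k (\<lambda>xs. f xs < g xs)"
  using decidable_le[OF computable_Suc[OF assms(1)] assms(2)] by (simp add: Suc_le_eq)

lemma decidable_eq:
  assumes "computable D k f" "computable D k g"
  shows "decidable D k (\<lambda>xs. f xs = g xs)"
  using decidable_conj[OF decidable_le[OF assms] decidable_le[OF assms(2,1)]]
  by (simp add: order_eq_iff)

lemma decidable_subst:
  assumes "decidable D (Suc k) (\<lambda>ys. P (hd ys) (tl ys))" "computable D k b"
  shows "decidable D k (\<lambda>xs. P (b xs) xs)"
  using computable_subst[where f = "\<lambda>z xs. of_bool (P z xs)"] assms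
  unfolding decidable_def by blast

lemma computable_Least:
  assumes P: "decidable D (Suc k) (\<lambda>ys. P (hd ys) (tl ys))"
    and ex: "\<And>xs. length xs = k \<Longrightarrow> \<exists>z. P z xs"
  shows "computable D k (\<lambda>xs. LEAST z. P z xs)"
  using computable_Least_zero[where f = "\<lambda>z xs. of_bool (\<not> P z xs)" and D = D and k = k]
    decidable_not[OF P] ex
  unfolding decidable_def by simp

text \<open>Stopping the search at \<open>b xs\<close> at the latest keeps it total. Testing
  \<open>P\<close> at the place where it stops settles the question, including the endpoint
  \<open>b xs\<close>.\<close>

lemma decidable_bex:
  assumes P: "decidable D (Suc k) (\<lambda>ys. P (hd ys) (tl ys))" and b: "computable D k b"
  shows "decidable D k (\<lambda>xs. \<exists>z\<le>b xs. P z xs)"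
proof -
  let ?z = "\<lambda>xs. LEAST z. b xs \<le> z \<or> P z xs"
  have "computable D k ?z"
    by (intro computable_Least decidable_disj decidable_le computable_tl[OF b] computable_hd P) auto
  then have "decidable D k (\<lambda>xs. P (?z xs) xs)"
    by (rule decidable_subst[OF P])
  moreover have "P (?z xs) xs \<longleftrightarrow> (\<exists>z\<le>b xs. P z xs)" for xs
  proof
    have "?z xs \<le> b xs" by (rule Least_le) simp
    then show "P (?z xs) xs \<Longrightarrow> \<exists>z\<le>b xs. P z xs" by blast
    assume "\<exists>z\<le>b xs. P z xs"
    then obtain z where z: "z \<le> b xs" "P z xs" by blast
    have "b xs \<le> ?z xs \<or> P (?z xs) xs" by (rule LeastI[where k = z]) (use z in simp)
    moreover have "?z xs \<le> z" by (rule Least_le) (use z in simp)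
    ultimately show "P (?z xs) xs" using z by (metis order_antisym order_trans)
  qed
  ultimately show ?thesis by simp
qed

lemma decidable_ball:
  assumes "decidable D (Suc k) (\<lambda>ys. P (hd ys) (tl ys))" "computable D k b"
  shows "decidable D k (\<lambda>xs. \<forall>z\<le>b xs. P z xs)"
  using decidable_not[OF decidable_bex[where P = "\<lambda>z xs. \<not> P z xs", OF decidable_not[OF assms(1)]
      assms(2)]] by simp

lemmas computable_intros =
  computable_const computable_hd computable_hd_tl computable_Suc computable_add computable_mult
  computable_diff computable_if decidable_le decidable_less decidable_eq decidable_not
  decidable_conj decidable_disj decidable_imp decidable_oracle

text \<open>A finite set is hard-coded into the program, one comparison per element. This absorbs
  initial segments of sets that may be far from computable.\<close>

lemma decidable_finite:
  assumes "finite B" "computable D k f"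
  shows "decidable D k (\<lambda>xs. f xs \<in> B)"
  using assms(1)
proof induction
  case empty
  then show ?case by (simp add: decidable_def computable_zero)
next
  case (insert b B)
  then show ?case using assms(2) by (simp add: computable_intros)
qed

text \<open>Membership says that \<open>g xs div 2 ^ f xs\<close> is odd. Powers come from
  recursion, quotients from minimization, and \<open>n\<close> is odd iff it exceeds
  \<open>2 * (n div 2)\<close>.\<close>

lemma decidable_set_decode:
  assumes "computable D k f" "computable D k g"
  shows "decidable D k (\<lambda>xs. f xs \<in> set_decode (g xs))"
proof -
  have pow: "rec_nat 1 (\<lambda>_ r. 2 * r) n = (2::nat) ^ n" for n by (induction n) auto
  have div: "(LEAST q. c < Suc q * b) = c div b" if "b > 0" for b c :: nat
    using that
    by (intro Least_equality) (auto simp: dividend_less_div_times div_less_iff_less_mult simp flip: less_Suc_eq_le)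
  have c_pow: "computable D k (\<lambda>xs. 2 ^ h xs)" if "computable D k h" for h k
    unfolding pow[symmetric]
    by (intro computable_rec computable_intros that)
  have c_div: "computable D k (\<lambda>xs. c xs div b xs)"
    if "computable D k b" "computable D k c" "\<And>xs. b xs > 0" for b c k
  proof -
    have "\<exists>q. c xs < Suc q * b xs" for xs
      using dividend_less_times_div[OF that(3)[of xs], of "c xs"]
      by (intro exI[of _ "c xs div b xs"]) (simp add: mult.commute)
    then have "computable D k (\<lambda>xs. LEAST q. c xs < Suc q * b xs)"
      by (intro computable_Least computable_intros computable_tl[OF that(1)]
          computable_tl[OF that(2)])
    then show ?thesis using div that(3) by simp
  qed
  have "decidable D k (\<lambda>xs. \<not> g xs div 2 ^ f xs \<le> 2 * (g xs div 2 ^ f xs div 2))"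
    by (intro computable_intros c_div c_pow assms) simp_all
  moreover have "odd n \<longleftrightarrow> \<not> n \<le> 2 * (n div 2)" for n :: nat
    by presburger
  ultimately show ?thesis by (simp only: set_decode_def mem_Collect_eq)
qed

section \<open>Evaluation with bounded resources\<close>

text \<open>
  The bound \<open>l\<close> limits both the oracle queries and the unbounded searches, so that only
  \<open>S \<inter> {..<l}\<close> matters. The value \<open>0\<close> signals that the bound was exceeded (or the arity is wrong)
  and \<open>Suc y\<close> signals the output \<open>y\<close>.
\<close>

fun beval :: "nat set \<Rightarrow> nat \<Rightarrow> oprog \<Rightarrow> nat list \<Rightarrow> nat" where
  "beval S l Zero xs = 1"
| "beval S l Succ xs = (if length xs = 1 then Suc (Suc (hd xs)) else 0)"
| "beval S l (Proj i) xs = (if i < length xs then Suc (xs ! i) else 0)"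
| "beval S l Query xs = (if length xs = 1 \<and> hd xs < l then Suc (of_bool (hd xs \<in> S)) else 0)"
| "beval S l (Comp f gs) xs =
    (if \<exists>g\<in>set gs. beval S l g xs = 0 then 0
     else beval S l f (map (\<lambda>g. beval S l g xs - 1) gs))"
| "beval S l (PrimRec f g) xs =
    (if xs = [] then 0
     else rec_nat (beval S l f (tl xs))
       (\<lambda>n r. if r = 0 then 0 else beval S l g (n # (r - 1) # tl xs)) (hd xs))"
| "beval S l (Mu f) xs =
    (let z = LEAST z. l \<le> z \<or> beval S l f (z # xs) \<le> 1
     in if z < l \<and> beval S l f (z # xs) = 1 then Suc z else 0)"

text \<open>The use principle: a nonzero value records a computation all of whose queries lie below
  \<open>l\<close>, so any oracle \<open>D\<close> that agrees with \<open>S\<close> there yields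
  the same output.\<close>

lemma beval_sound:
  assumes "beval S l p xs = Suc y" "D \<inter> {..<l} = S \<inter> {..<l}"
  shows "oeval D p xs y"
  using assms(1)
proof (induction p arbitrary: xs y)
  case Zero
  then show ?case by (auto intro: oeval_Zero)
next
  case Succ
  then show ?case by (auto simp: length_Suc_conv intro: oeval_Succ split: if_splits)
next
  case (Proj i)
  then show ?case by (auto intro: oeval_Proj split: if_splits)
next
  case Query
  then obtain x where x: "xs = [x]" "x < l" "y = of_bool (x \<in> S)"
    by (auto simp: length_Suc_conv split: if_splits)
  then have "x \<in> S \<longleftrightarrow> x \<in> D" using assms(2) by blast
  then show ?case using x oeval_Query[of D x] by simp
next
  case (Comp f gs)
  have nz: "beval S l g xs \<noteq> 0" if "g \<in> set gs" for g
    using Comp.prems that by (auto split: if_splits)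
  show ?case
  proof (rule oeval_Comp)
    show "oeval D f (map (\<lambda>g. beval S l g xs - 1) gs) y"
      using Comp.prems by (intro Comp.IH(1)) (auto split: if_splits)
    show "list_all2 (\<lambda>g y. oeval D g xs y) gs (map (\<lambda>g. beval S l g xs - 1) gs)"
      using nz by (auto simp: list_all2_conv_all_nth intro!: Comp.IH(2))
  qed
next
  case (PrimRec f g)
  then obtain n ys where xs: "xs = n # ys" by (cases xs) auto
  have "oeval D (PrimRec f g) (n # ys) y"
    if "rec_nat (beval S l f ys) (\<lambda>n r. if r = 0 then 0 else beval S l g (n # (r - 1) # ys)) n = Suc y"
    for y
    using that
  proof (induction n arbitrary: y)
    case 0
    then show ?case using PrimRec.IH(1) by (auto intro: oeval_PrimRec_0)
  next
    case (Suc n)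
    let ?r = "rec_nat (beval S l f ys)
      (\<lambda>n r. if r = 0 then 0 else beval S l g (n # (r - 1) # ys)) n"
    have "?r \<noteq> 0" using Suc.prems by (auto split: if_splits)
    then obtain r where r: "?r = Suc r" by (cases ?r) auto
    have "oeval D g (n # r # ys) y"
      using Suc.prems r by (intro PrimRec.IH(2)) simp
    with Suc.IH[OF r] show ?case by (rule oeval_PrimRec_Suc)
  qed
  then show ?case using PrimRec.prems xs by (simp cong: if_cong)
next
  case (Mu f)
  \<comment> \<open>The search stops at a zero of \<open>f\<close> (value 1), at a failed evaluation
    (value 0) or at \<open>l\<close>. Before \<open>z\<close> all values are at least 2, hence stand
    for nonzero outputs.\<close>
  define z where "z = (LEAST z. l \<le> z \<or> beval S l f (z # xs) \<le> 1)"
  have z: "z < l" "beval S l f (z # xs) = 1" "y = z"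
    using Mu.prems by (auto simp: z_def Let_def split: if_splits)
  have "\<exists>v. oeval D f (w # xs) (Suc v)" if "w < z" for w
  proof -
    have "\<not> (l \<le> w \<or> beval S l f (w # xs) \<le> 1)"
      using not_less_Least that unfolding z_def by blast
    then obtain v where "beval S l f (w # xs) = Suc (Suc v)"
      by (metis One_nat_def Suc_le_D not_less_eq_eq linorder_not_le)
    then show ?thesis using Mu.IH by blast
  qed
  then show ?case using z Mu.IH[of "z # xs" 0] by (auto intro: oeval_Mu)
qed

text \<open>A halting computation uses finitely many queries and searches. Claiming the result for
  all large \<open>l\<close> lets finitely many subcomputations share a bound.\<close>

lemma beval_complete:
  assumes "oeval D p xs y"
  shows "\<forall>\<^sub>F l in sequentially. beval D l p xs = Suc y"
  using assms
proof induction
  case (oeval_Query x)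
  show ?case using eventually_gt_at_top[of x] by eventually_elim simp
next
  case (oeval_Comp xs gs ys f z)
  have len: "length ys = length gs"
    using oeval_Comp.IH(1) by (simp add: list_all2_lengthD)
  have "\<forall>\<^sub>F l in sequentially. \<forall>i\<in>{..<length gs}. beval D l (gs ! i) xs = Suc (ys ! i)"
    using oeval_Comp.IH(1) by (intro eventually_ball_finite) (auto simp: list_all2_conv_all_nth)
  then show ?case using oeval_Comp.IH(2)
  proof eventually_elim
    case (elim l)
    have "map (\<lambda>g. beval D l g xs - 1) gs = ys"
      using elim(1) len by (intro nth_equalityI) auto
    moreover have "\<forall>g\<in>set gs. beval D l g xs \<noteq> 0"
      using elim(1) by (auto simp: in_set_conv_nth)
    ultimately show ?case using elim(2) by simp
  qed
next
  case (oeval_PrimRec_Suc f g n xs r y)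
  show ?case using oeval_PrimRec_Suc.IH by eventually_elim (simp cong: if_cong)
next
  case (oeval_Mu f z xs)
  have "\<forall>\<^sub>F l in sequentially. \<forall>w\<in>{..<z}. \<exists>v. beval D l f (w # xs) = Suc (Suc v)"
  proof (intro eventually_ball_finite ballI)
    fix w assume "w \<in> {..<z}"
    then obtain v where "\<forall>\<^sub>F l in sequentially. beval D l f (w # xs) = Suc (Suc v)"
      using oeval_Mu.IH(2) by blast
    then show "\<forall>\<^sub>F l in sequentially. \<exists>v. beval D l f (w # xs) = Suc (Suc v)"
      by eventually_elim blast
  qed simp
  then show ?case using oeval_Mu.IH(1) eventually_gt_at_top[of z]
  proof eventually_elim
    case (elim l)
    have "(LEAST z. l \<le> z \<or> beval D l f (z # xs) \<le> 1) = z"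
    proof (rule Least_equality)
      show "l \<le> z \<or> beval D l f (z # xs) \<le> 1" using elim by simp
      show "z \<le> w" if "l \<le> w \<or> beval D l f (w # xs) \<le> 1" for w
      proof (rule ccontr)
        assume "\<not> z \<le> w"
        then have "w < z" by simp
        then obtain v where "beval D l f (w # xs) = Suc (Suc v)" using elim(1) by blast
        with \<open>w < z\<close> that elim(3) show False by auto
      qed
    qed
    then show ?case using elim by simp
  qed
qed simp_all

section \<open>Searching with a computable evaluator\<close>

text \<open>The program is fixed, and induction on it assembles a computable function from those of
  its subprograms. The oracle is given by a code \<open>c xs\<close> that varies with the arguments.
  Arity, code, bound and arguments are generalized because recursion and minimization put new
  variables in front.\<close>

lemma computable_beval:
  assumes F: "\<And>j u c. computable D j u \<Longrightarrow> computable D j c \<Longrightarrow> decidable D j (\<lambda>xs. u xs \<in> F (c xs))"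
    and "computable D j c" "computable D j b" "\<And>g. g \<in> set gs \<Longrightarrow> computable D j g"
  shows "computable D j (\<lambda>xs. beval (F (c xs)) (b xs) p (map (\<lambda>g. g xs) gs))"
  using assms(2-)
proof (induction p arbitrary: j c b gs)
  case Zero
  show ?case by (simp add: computable_const)
next
  case Succ
  then show ?case
    by (cases "length gs = 1")
       (auto simp: computable_const length_Suc_conv intro!: computable_intros)
next
  case (Proj i)
  then show ?case
    by (cases "i < length gs") (auto simp: computable_const intro!: computable_intros)
next
  case Query
  show ?case
  proof (cases "length gs = 1")
    case True
    then obtain g where gs: "gs = [g]" by (auto simp: length_Suc_conv)
    have "computable D j (\<lambda>xs. if g xs < b xs then Suc (of_bool (g xs \<in> F (c xs))) else 0)"
      using Query gs F[of j g c] unfolding decidable_def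
      by (intro computable_intros) auto
    then show ?thesis using gs by (simp cong: if_cong)
  next
    case False
    then show ?thesis by (simp add: computable_const)
  qed
next
  case (Comp f hs)
  let ?h = "\<lambda>h xs. beval (F (c xs)) (b xs) h (map (\<lambda>g. g xs) gs)"
  have h: "computable D j (?h h)" if "h \<in> set hs" for h
    using that Comp.prems by (intro Comp.IH(2)) auto
  have "decidable D j (\<lambda>xs. \<exists>h\<in>set hs'. ?h h xs = 0)" if "set hs' \<subseteq> set hs" for hs'
    using that
  proof (induction hs')
    case Nil
    then show ?case by (simp add: decidable_def computable_zero)
  next
    case (Cons h hs')
    then show ?case using h by (simp add: computable_intros)
  qed
  then have dec: "decidable D j (\<lambda>xs. \<exists>h\<in>set hs. ?h h xs = 0)" by blast
  have "computable D j (\<lambda>xs. beval (F (c xs)) (b xs) f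
      (map (\<lambda>g. g xs) (map (\<lambda>h xs. ?h h xs - 1) hs)))"
    using Comp.prems h by (intro Comp.IH(1)) (auto intro!: computable_pred[unfolded One_nat_def])
  then have "computable D j (\<lambda>xs. beval (F (c xs)) (b xs) f (map (\<lambda>h. ?h h xs - 1) hs))"
    by (simp add: o_def)
  from computable_if[OF dec computable_zero this] show ?case by simp
next
  case (PrimRec f g)
  show ?case
  proof (cases gs)
    case Nil
    then show ?thesis by (simp add: computable_const)
  next
    case (Cons u us)
    have f: "computable D j (\<lambda>xs. beval (F (c xs)) (b xs) f (map (\<lambda>g. g xs) us))"
      using PrimRec.prems Cons by (intro PrimRec.IH(1)) auto
    have tl2: "computable D (Suc (Suc j)) (\<lambda>ys. h (tl (tl ys)))" if "computable D j h" for h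
      using that by (intro computable_tl)
    have "computable D (Suc (Suc j)) (\<lambda>ys. beval (F (c (tl (tl ys)))) (b (tl (tl ys))) g
        (map (\<lambda>g. g ys) (hd # (\<lambda>ys. hd (tl ys) - 1) # map (\<lambda>g ys. g (tl (tl ys))) us)))"
      using PrimRec.prems Cons
      by (intro PrimRec.IH(2))
         (auto intro: tl2 computable_hd computable_hd_tl computable_pred[unfolded One_nat_def])
    then have "computable D (Suc (Suc j)) (\<lambda>ys. if hd (tl ys) = 0 then 0 else
        beval (F (c (tl (tl ys)))) (b (tl (tl ys))) g
          (hd ys # (hd (tl ys) - 1) # map (\<lambda>g. g (tl (tl ys))) us))"
      by (intro computable_intros) (simp add: o_def)
    from computable_rec[where g = "\<lambda>n r xs. if r = 0 then 0 else
        beval (F (c xs)) (b xs) g (n # (r - 1) # map (\<lambda>g. g xs) us)", OF f this, of u]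
    show ?thesis using PrimRec.prems Cons by (simp cong: if_cong)
  qed
next
  case (Mu f)
  let ?f = "\<lambda>z xs. beval (F (c xs)) (b xs) f (z # map (\<lambda>g. g xs) gs)"
  let ?z = "\<lambda>xs. LEAST z. b xs \<le> z \<or> ?f z xs \<le> 1"
  have "computable D (Suc j) (\<lambda>ys. beval (F (c (tl ys))) (b (tl ys)) f
        (map (\<lambda>g. g ys) (hd # map (\<lambda>g ys. g (tl ys)) gs)))"
    using Mu.prems by (intro Mu.IH) (auto intro!: computable_tl computable_hd)
  then have f: "computable D (Suc j) (\<lambda>ys. ?f (hd ys) (tl ys))"
    by (simp add: o_def)
  then have z: "computable D j ?z"
    using Mu.prems by (intro computable_Least computable_intros) (auto intro: computable_tl)
  have "computable D j (\<lambda>xs. ?f (?z xs) xs)"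
    using computable_subst[OF f z] .
  then have "computable D j (\<lambda>xs. if ?z xs < b xs \<and> ?f (?z xs) xs = 1 then Suc (?z xs) else 0)"
    using z Mu.prems by (intro computable_intros)
  then show ?case by (simp add: Let_def cong: if_cong)
qed

text \<open>All pairs of a bound \<open>t\<close> and an oracle code \<open>c\<close> are searched
  for one that satisfies \<open>Q\<close> and makes \<open>p\<close> converge. Any hit gives the
  right answer, so it does not matter which one is found.\<close>

lemma turing_reducible_search:
  assumes F: "\<And>j u c. computable D j u \<Longrightarrow> computable D j c \<Longrightarrow> decidable D j (\<lambda>xs. u xs \<in> F (c xs))"
    and Q: "\<And>j t c. computable D j t \<Longrightarrow> computable D j c \<Longrightarrow> decidable D j (\<lambda>xs. Q (t xs) (c xs))"
    and ex: "\<And>n. \<exists>t c. Q t c \<and> beval (F c) t p [n] \<noteq> 0"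
    and correct: "\<And>n t c. Q t c \<Longrightarrow> beval (F c) t p [n] \<noteq> 0 \<Longrightarrow>
      beval (F c) t p [n] = Suc (of_bool (n \<in> A))"
  shows "A \<le>\<^sub>T D"
proof -
  let ?E = "\<lambda>c t n. beval (F c) t p [n]"
  have E: "computable D (Suc (Suc (Suc (Suc 0))))
      (\<lambda>ys. ?E (hd ys) (hd (tl ys)) (hd (tl (tl (tl ys)))))"
  proof -
    have "computable D (Suc (Suc (Suc (Suc 0)))) (\<lambda>ys. beval (F (hd ys)) (hd (tl ys)) p
        (map (\<lambda>g. g ys) [\<lambda>ys. hd (tl (tl (tl ys)))]))"
      by (rule computable_beval, rule F)
         (auto intro: computable_hd computable_hd_tl computable_tl[OF computable_tl[OF computable_hd_tl]])
    then show ?thesis by simp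
  qed
  \<comment> \<open>One number bounds both \<open>t\<close> and \<open>c\<close>, so a single
    minimization suffices. As outputs are shifted by one, \<open>v = 1\<close> tests for convergence
    and \<open>v = 2\<close> for a positive answer.\<close>
  have dec: "decidable D (Suc (Suc 0)) (\<lambda>ys. \<exists>t\<le>hd ys. \<exists>c\<le>hd ys. Q t c \<and> v \<le> ?E c t (hd (tl ys)))" for v
    by (intro decidable_bex computable_intros Q E)
  let ?w = "\<lambda>xs. LEAST w. \<exists>t\<le>w. \<exists>c\<le>w. Q t c \<and> 1 \<le> ?E c t (hd xs)"
  have total: "\<exists>w. \<exists>t\<le>w. \<exists>c\<le>w. Q t c \<and> 1 \<le> ?E c t n" for n
  proof -
    obtain t c where "Q t c" "?E c t n \<noteq> 0" using ex by blast
    then have "t \<le> max t c \<and> c \<le> max t c \<and> Q t c \<and> 1 \<le> ?E c t n" by auto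
    then show ?thesis by blast
  qed
  have w: "computable D (Suc 0) ?w"
    by (intro computable_Least dec total)
  have "decidable D (Suc 0) (\<lambda>xs. \<exists>t\<le>?w xs. \<exists>c\<le>?w xs. Q t c \<and> 2 \<le> ?E c t (hd xs))"
    by (rule decidable_subst[OF dec w])
  moreover have "(\<exists>t\<le>?w xs. \<exists>c\<le>?w xs. Q t c \<and> 2 \<le> ?E c t (hd xs)) \<longleftrightarrow> hd xs \<in> A" for xs
  proof -
    obtain t c where tc: "t \<le> ?w xs" "c \<le> ?w xs" "Q t c" "1 \<le> ?E c t (hd xs)"
      using LeastI_ex[OF total[of "hd xs"]] by blast
    have val: "?E c t (hd xs) = Suc (of_bool (hd xs \<in> A))" if "Q t c" "1 \<le> ?E c t (hd xs)" for t c
      using that by (intro correct) auto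
    show ?thesis
    proof
      assume "\<exists>t\<le>?w xs. \<exists>c\<le>?w xs. Q t c \<and> 2 \<le> ?E c t (hd xs)"
      then obtain t c where "Q t c" "2 \<le> ?E c t (hd xs)" by blast
      then show "hd xs \<in> A" using val[of t c] by (cases "hd xs \<in> A") auto
    next
      assume "hd xs \<in> A"
      then have "2 \<le> ?E c t (hd xs)"
        using val[OF tc(3,4)] by simp
      with tc(1-3) show "\<exists>t\<le>?w xs. \<exists>c\<le>?w xs. Q t c \<and> 2 \<le> ?E c t (hd xs)"
        by blast
    qed
  qed
  ultimately have "computable D (Suc 0) (\<lambda>xs. of_bool (hd xs \<in> A))"
    by (simp only: decidable_def)
  then obtain q where "\<And>xs. length xs = Suc 0 \<Longrightarrow> oeval D q xs (of_bool (hd xs \<in> A))"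
    unfolding computable_def by blast
  from this[of "[n]" for n] show ?thesis
    unfolding turing_reducible_def by (intro exI[of _ q]) simp
qed

instance oprog :: countable
  by countable_datatype

lemma Int_lessThan_eq_iff: "S \<inter> {..<l} = T \<inter> {..<l} \<longleftrightarrow> (\<forall>k<l. k \<in> S \<longleftrightarrow> k \<in> T)"
  for l :: nat
  by auto

lemma beval_cong:
  assumes "S \<inter> {..<l} = T \<inter> {..<l}"
  shows "beval S l p xs = beval T l p xs"
proof (induction p arbitrary: xs)
  case Query
  have "x \<in> S \<longleftrightarrow> x \<in> T" if "x < l" for x using assms that by blast
  then show ?case by auto
next
  case (Comp f gs)
  then show ?case by (auto cong: map_cong)
qed (simp_all cong: if_cong)

section \<open>Counting disagreements\<close>

text \<open>Counts in place of quotients turn density bounds into inequalities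
  \<open>K * disagreements S T m \<le> m\<close> between natural numbers, which programs can
  decide.\<close>

definition disagreements :: "nat set \<Rightarrow> nat set \<Rightarrow> nat \<Rightarrow> nat" where
  "disagreements S T m = card (sym_diff S T \<inter> {..<m})"

lemma disagreements_cong:
  assumes "S \<inter> {..<l} = S' \<inter> {..<l}" "m \<le> l"
  shows "disagreements S T m = disagreements S' T m"
proof -
  have "k \<in> S \<longleftrightarrow> k \<in> S'" if "k < m" for k using assms that by (simp add: Int_lessThan_eq_iff)
  then have "sym_diff S T \<inter> {..<m} = sym_diff S' T \<inter> {..<m}" by auto
  then show ?thesis by (simp add: disagreements_def)
qed

lemma disagreements_commute: "disagreements S T m = disagreements T S m"
  by (simp add: disagreements_def Un_commute)

lemma disagreements_triangle:
  "disagreements S U m \<le> disagreements S T m + disagreements T U m"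
proof -
  have "sym_diff S U \<inter> {..<m} \<subseteq> (sym_diff S T \<inter> {..<m}) \<union> (sym_diff T U \<inter> {..<m})" by auto
  then have "disagreements S U m \<le> card ((sym_diff S T \<inter> {..<m}) \<union> (sym_diff T U \<inter> {..<m}))"
    unfolding disagreements_def by (intro card_mono) auto
  also have "\<dots> \<le> disagreements S T m + disagreements T U m"
    unfolding disagreements_def by (rule card_Un_le)
  finally show ?thesis .
qed

lemma disagreements_le_self: "disagreements S T m \<le> m"
  unfolding disagreements_def using card_mono[of "{..<m}" "sym_diff S T \<inter> {..<m}"] by simp

text \<open>This form makes the count computable by primitive recursion.\<close>

lemma disagreements_eq_rec:
  "disagreements S T m = rec_nat 0 (\<lambda>i r. r + of_bool (\<not> (i \<in> S \<longleftrightarrow> i \<in> T))) m"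
proof (induction m)
  case (Suc m)
  have "sym_diff S T \<inter> {..<Suc m} =
      (if m \<in> S \<longleftrightarrow> m \<in> T then sym_diff S T \<inter> {..<m} else insert m (sym_diff S T \<inter> {..<m}))"
    by (auto simp: lessThan_Suc)
  with Suc show ?case by (auto simp: disagreements_def)
qed (simp add: disagreements_def)

lemma disagreements_mono_set:
  "sym_diff S T \<subseteq> sym_diff S' T' \<Longrightarrow> disagreements S T m \<le> disagreements S' T' m"
  unfolding disagreements_def by (intro card_mono) auto

lemma partial_density_sym_diff:
  "partial_density m (sym_diff S T) = real (disagreements S T m) / real m"
  by (simp add: partial_density_def disagreements_def lessThan_atLeast0)

lemma computable_disagreements:
  assumes F: "\<And>j u c. computable D j u \<Longrightarrow> computable D j c \<Longrightarrow> decidable D j (\<lambda>xs. u xs \<in> F (c xs))"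
    and B: "\<And>j u. computable D j u \<Longrightarrow> decidable D j (\<lambda>xs. u xs \<in> B)"
    and "computable D j c" "computable D j m"
  shows "computable D j (\<lambda>xs. disagreements (F (c xs)) B (m xs))"
proof -
  have c: "computable D (Suc (Suc j)) (\<lambda>ys. c (tl (tl ys)))"
    using assms(3) by (intro computable_tl)
  have "decidable D (Suc (Suc j)) (\<lambda>ys. (hd ys \<in> F (c (tl (tl ys))) \<longrightarrow> hd ys \<in> B) \<and>
      (hd ys \<in> B \<longrightarrow> hd ys \<in> F (c (tl (tl ys)))))"
    by (intro computable_intros F B c)
  then have "decidable D (Suc (Suc j)) (\<lambda>ys. \<not> (hd ys \<in> F (c (tl (tl ys))) \<longleftrightarrow> hd ys \<in> B))"
    by (intro decidable_not) (simp only: iff_conv_conj_imp)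
  then show ?thesis
    unfolding disagreements_eq_rec
    by (intro computable_rec computable_add computable_hd_tl computable_zero assms(4))
       (simp only: decidable_def)
qed

text \<open>The factor 2 leaves room for a strict bound \<open>1 / K\<close> on the limit superior,
  and a strict bound holds at almost all lengths.\<close>

lemma eventually_disagreements_le:
  assumes "upper_density (sym_diff S T) \<le> ereal (1 / (2 * real K))" "K > 0"
  shows "\<forall>\<^sub>F m in sequentially. K * disagreements S T m \<le> m"
proof -
  have "upper_density (sym_diff S T) < ereal (1 / real K)"
    using assms by (auto elim!: le_less_trans simp: field_simps)
  then have "\<forall>\<^sub>F m in sequentially. ereal (partial_density m (sym_diff S T)) < ereal (1 / real K)"
    unfolding upper_density_def by (rule Limsup_lessD)
  then show ?thesis
    using eventually_gt_at_top[of 0]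
  proof eventually_elim
    case (elim m)
    then have "real K * real (disagreements S T m) < real m"
      using assms(2) by (simp add: partial_density_sym_diff field_simps)
    then show ?case by (simp flip: of_nat_mult)
  qed
qed

section \<open>The construction\<close>

text \<open>A finite string is represented by a set and a length: only \<open>S\<close> below
  \<open>s\<close> and \<open>T\<close> below \<open>t\<close> matter. The allowed density of errors
  is \<open>1 / K\<close>.\<close>

definition close_extension :: "nat \<Rightarrow> nat set \<Rightarrow> nat set \<Rightarrow> nat \<Rightarrow> nat set \<Rightarrow> nat \<Rightarrow> bool" where
  "close_extension K X S s T t \<longleftrightarrow>
    s \<le> t \<and> T \<inter> {..<s} = S \<inter> {..<s} \<and> (\<forall>m\<in>{s..t}. K * disagreements T X m \<le> m)"

text \<open>Lengths up to \<open>t\<close> inherit the bound from \<open>T\<close>, with which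
  \<open>U\<close> agrees there; longer ones have it from \<open>U\<close>.\<close>

lemma close_extension_trans:
  assumes T: "close_extension K X S s T t" and U: "close_extension K X T t U u"
  shows "close_extension K X S s U u"
  unfolding close_extension_def
proof (intro conjI ballI)
  have agree: "U \<inter> {..<t} = T \<inter> {..<t}" using U by (simp add: close_extension_def)
  show "s \<le> u" using T U by (simp add: close_extension_def)
  show "U \<inter> {..<s} = S \<inter> {..<s}"
    using T agree by (simp add: close_extension_def Int_lessThan_eq_iff)
  show "K * disagreements U X m \<le> m" if "m \<in> {s..u}" for m
    using that T U disagreements_cong[OF agree, of m X]
    by (cases "m \<le> t") (auto simp: close_extension_def)
qed

section \<open>Computing the set from a close oracle\<close>

text \<open>The search runs through the strings within \<open>1 / (2 * K)\<close> of a finite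
  variant of \<open>D\<close>, which lies within \<open>1 / (4 * K)\<close> of \<open>X\<close>. By
  the triangle inequality they include the strings within \<open>1 / (4 * K)\<close> of
  \<open>X\<close>, so a hit exists, and all lie within \<open>1 / K\<close> of \<open>X\<close>, so
  every hit is correct.\<close>

lemma turing_reducible_close_oracle:
  assumes D: "\<forall>\<^sub>F m in sequentially. 4 * K * disagreements X D m \<le> m"
    and ex: "\<And>n. \<exists>T t. close_extension (4 * K) X S s T t \<and> beval T t p [n] \<noteq> 0"
    and correct: "\<And>n T t. close_extension K X S s T t \<Longrightarrow> beval T t p [n] \<noteq> 0 \<Longrightarrow>
      beval T t p [n] = Suc (of_bool (n \<in> A))"
  shows "A \<le>\<^sub>T D"
proof -
  obtain M where M: "\<And>m. m \<ge> M \<Longrightarrow> 4 * K * disagreements X D m \<le> m"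
    using D unfolding eventually_sequentially by blast
  \<comment> \<open>A finite correction of \<open>D\<close> makes the bound hold at every length
    while staying decidable from \<open>D\<close>.\<close>
  define B where "B = (X \<inter> {..<M}) \<union> (D \<inter> {M..})"
  have B: "4 * K * disagreements X B m \<le> m" for m
  proof (cases "m \<ge> M")
    case True
    have "disagreements X B m \<le> disagreements X D m"
      by (rule disagreements_mono_set) (auto simp: B_def)
    then have "4 * K * disagreements X B m \<le> 4 * K * disagreements X D m" by simp
    then show ?thesis using M[OF True] by linarith
  next
    case False
    have "disagreements X B m = disagreements B B m"
      by (rule disagreements_cong[of _ m]) (use False in \<open>auto simp: B_def\<close>)
    then show ?thesis by (simp add: disagreements_def)
  qed
  \<comment> \<open>The code \<open>c\<close> supplies the bits from \<open>s\<close> on; those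
    below \<open>s\<close> are forced to be those of \<open>S\<close>.\<close>
  define F where "F c = (S \<inter> {..<s}) \<union> (set_decode c \<inter> {s..})" for c
  have dec_F: "decidable D j (\<lambda>xs. u xs \<in> F (c xs))" if "computable D j u" "computable D j c" for j u c
  proof -
    have "decidable D j (\<lambda>xs. u xs \<in> S \<inter> {..<s} \<or> u xs \<in> set_decode (c xs) \<and> s \<le> u xs)"
      using that by (intro computable_intros decidable_finite decidable_set_decode) auto
    then show ?thesis by (simp add: F_def)
  qed
  have dec_B: "decidable D j (\<lambda>xs. u xs \<in> B)" if "computable D j u" for j u
  proof -
    have "decidable D j (\<lambda>xs. u xs \<in> X \<inter> {..<M} \<or> u xs \<in> D \<and> M \<le> u xs)"
      using that by (intro computable_intros decidable_finite) auto
    then show ?thesis by (simp add: B_def)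
  qed
  \<comment> \<open>Distance is measured from \<open>B\<close> rather than \<open>X\<close>, because
    \<open>D\<close> can decide it.\<close>
  define Q where "Q t c \<longleftrightarrow> s \<le> t \<and> (\<forall>m\<le>t. s \<le> m \<longrightarrow> 2 * K * disagreements (F c) B m \<le> m)" for t c
  have dec_Q: "decidable D j (\<lambda>xs. Q (t xs) (c xs))" if "computable D j t" "computable D j c" for j t c
    unfolding Q_def
    by (intro computable_intros decidable_ball computable_disagreements dec_F dec_B
        computable_tl[OF that(2)] that)
  show ?thesis
  proof (rule turing_reducible_search[where F = F and Q = Q and p = p])
    show "\<exists>t c. Q t c \<and> beval (F c) t p [n] \<noteq> 0" for n
    proof -
      obtain T t where T: "s \<le> t" "T \<inter> {..<s} = S \<inter> {..<s}"
        "\<And>m. m \<in> {s..t} \<Longrightarrow> 4 * K * disagreements T X m \<le> m" "beval T t p [n] \<noteq> 0"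
        using ex[of n] unfolding close_extension_def by blast
      define c where "c = set_encode (T \<inter> {..<t})"
      have F: "F c \<inter> {..<t} = T \<inter> {..<t}"
        using T(2) unfolding Int_lessThan_eq_iff by (auto simp: F_def c_def)
      have "2 * K * disagreements (F c) B m \<le> m" if "m \<le> t" "s \<le> m" for m
      proof -
        \<comment> \<open>The errors against \<open>X\<close> and those of \<open>B\<close> add up:
          \<open>1 / (4 * K) + 1 / (4 * K) = 1 / (2 * K)\<close>.\<close>
        have "4 * K * disagreements (F c) B m \<le> 4 * K * (disagreements T X m + disagreements X B m)"
          using disagreements_triangle[of T B m X] disagreements_cong[OF F that(1)] by simp
        also have "\<dots> \<le> m + m"
          using T(3)[of m] B[of m] that by (simp add: distrib_left)
        finally show ?thesis by simp
      qed
      then have "Q t c" using T(1) by (simp add: Q_def)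
      then show ?thesis using T(4) beval_cong[OF F] by metis
    qed
    show "beval (F c) t p [n] = Suc (of_bool (n \<in> A))"
      if Q: "Q t c" and nz: "beval (F c) t p [n] \<noteq> 0" for n t c
    proof (rule correct[OF _ nz], unfold close_extension_def, intro conjI)
      show "s \<le> t" using Q by (simp add: Q_def)
      show "F c \<inter> {..<s} = S \<inter> {..<s}" by (auto simp: F_def)
      show "\<forall>m\<in>{s..t}. K * disagreements (F c) X m \<le> m"
      proof
        fix m assume "m \<in> {s..t}"
        then have "2 * K * disagreements (F c) B m \<le> m" using Q by (simp add: Q_def)
        \<comment> \<open>Here \<open>1 / (2 * K) + 1 / (4 * K)\<close> stays below
          \<open>1 / K\<close>.\<close>
        moreover have "K * disagreements (F c) X m \<le>
            K * (disagreements (F c) B m + disagreements X B m)"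
          using disagreements_triangle[of "F c" X m B] disagreements_commute[of B X m]
          by (intro mult_left_mono) auto
        ultimately show "K * disagreements (F c) X m \<le> m"
          using B[of m] by (simp add: distrib_left)
      qed
    qed
  qed (fact dec_F dec_Q)+
qed

section \<open>One stage of the construction\<close>

text \<open>Copying \<open>X\<close> from \<open>s\<close> on adds no errors, so their proportion
  falls below any prescribed \<open>1 / L\<close> once the string is long enough.\<close>

lemma extend_close:
  assumes "K * disagreements S X s \<le> s"
  shows "\<exists>T t. s < t \<and> close_extension K X S s T t \<and> L * disagreements T X t \<le> t"
proof -
  define T where "T = (S \<inter> {..<s}) \<union> (X \<inter> {s..})"
  \<comment> \<open>At most \<open>s\<close> errors occur, so \<open>L * s\<close> places outweigh
    them; \<open>Suc s\<close> forces strict growth.\<close>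
  define t where "t = Suc s + L * s"
  have "s < t" by (simp add: t_def)
  have eq: "disagreements T X m = disagreements S X s" if "s \<le> m" for m
  proof -
    have "sym_diff T X \<inter> {..<m} = sym_diff S X \<inter> {..<s}" using that by (auto simp: T_def)
    then show ?thesis by (simp add: disagreements_def)
  qed
  have "L * disagreements T X t = L * disagreements S X s" using eq[of t] \<open>s < t\<close> by simp
  also have "\<dots> \<le> L * s" by (intro mult_left_mono disagreements_le_self) simp
  also have "\<dots> \<le> t" by (simp add: t_def)
  finally have "L * disagreements T X t \<le> t" .
  moreover have "close_extension K X S s T t"
    using assms \<open>s < t\<close> by (auto simp: close_extension_def eq) (auto simp: T_def)
  ultimately show ?thesis using \<open>s < t\<close> by blast
qed

text \<open>Here \<open>Z\<close> stands for the set finally built: the program fails on every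
  \<open>Z\<close> that respects the sharper bound from \<open>t\<close> on. The bound at
  \<open>t\<close> itself is what the next stage starts from.\<close>

lemma diagonalization_step:
  assumes S: "K * disagreements S X s \<le> s"
    and D: "\<forall>\<^sub>F m in sequentially. 4 * K * disagreements X D m \<le> m" "\<not> A \<le>\<^sub>T D"
  shows "\<exists>T t. s < t \<and> close_extension K X S s T t \<and> 4 * K * disagreements T X t \<le> t \<and>
    (\<forall>Z. (\<forall>u\<ge>t. close_extension (4 * K) X T t Z u) \<longrightarrow>
      \<not> (\<forall>n. oeval Z p [n] (of_bool (n \<in> A))))"
proof (cases "\<exists>n T t. close_extension K X S s T t \<and> beval T t p [n] \<noteq> 0 \<and>
    beval T t p [n] \<noteq> Suc (of_bool (n \<in> A))")
  case True
  then obtain n T t where T: "close_extension K X S s T t"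
    "beval T t p [n] \<noteq> 0" "beval T t p [n] \<noteq> Suc (of_bool (n \<in> A))"
    by blast
  then obtain y where y: "beval T t p [n] = Suc y" "y \<noteq> of_bool (n \<in> A)"
    by (cases "beval T t p [n]") auto
  have "K * disagreements T X t \<le> t" using T(1) by (simp add: close_extension_def)
  \<comment> \<open>The wrong value depends only on bits below \<open>t\<close>, so it survives the
    passage to the sharper bound.\<close>
  from extend_close[OF this, of "4 * K"] obtain T' t' where
    T': "t < t'" "close_extension K X T t T' t'" "4 * K * disagreements T' X t' \<le> t'"
    by blast
  have "\<not> (\<forall>n. oeval Z p [n] (of_bool (n \<in> A)))" if "\<forall>u\<ge>t'. close_extension (4 * K) X T' t' Z u" for Z
  proof -
    have "Z \<inter> {..<t} = T \<inter> {..<t}"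
      using that T'(1,2) by (auto simp: close_extension_def Int_lessThan_eq_iff)
    then have "oeval Z p [n] y" by (rule beval_sound[OF y(1)])
    then show ?thesis using y(2) oeval_deterministic by blast
  qed
  moreover have "s < t'" using T(1) T'(1) by (simp add: close_extension_def)
  ultimately show ?thesis using T'(3) close_extension_trans[OF T(1) T'(2)] by blast
next
  case False
  \<comment> \<open>\<open>X\<close> is copied first because extensions obeying the sharper bound
    must already satisfy it at their starting length.\<close>
  obtain T t where T: "s < t" "close_extension K X S s T t" "4 * K * disagreements T X t \<le> t"
    using extend_close[OF S, of "4 * K"] by blast
  have "\<exists>n. \<forall>T' t'. close_extension (4 * K) X T t T' t' \<longrightarrow> beval T' t' p [n] = 0"
  proof (rule ccontr)
    assume contr: "\<not> ?thesis"
    have "A \<le>\<^sub>T D"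
    proof (rule turing_reducible_close_oracle[OF D(1), where s = t and S = T and p = p])
      show "\<exists>T' t'. close_extension (4 * K) X T t T' t' \<and> beval T' t' p [n] \<noteq> 0" for n
        using contr by blast
      show "beval T' t' p [n] = Suc (of_bool (n \<in> A))"
        if "close_extension K X T t T' t'" "beval T' t' p [n] \<noteq> 0" for n T' t'
        using False that(2) close_extension_trans[OF T(2) that(1)] by blast
    qed
    with D(2) show False ..
  qed
  then obtain n where n:
    "\<And>T' t'. close_extension (4 * K) X T t T' t' \<Longrightarrow> beval T' t' p [n] = 0"
    by blast
  \<comment> \<open>If \<open>p\<close> converged on \<open>Z\<close> at \<open>n\<close>, then
    \<open>Z\<close> cut off at a large \<open>l\<close> would be an extension showing it.\<close>
  have "\<not> (\<forall>n. oeval Z p [n] (of_bool (n \<in> A)))" if Z: "\<forall>u\<ge>t. close_extension (4 * K) X T t Z u" for Z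
  proof
    assume "\<forall>n. oeval Z p [n] (of_bool (n \<in> A))"
    then have "oeval Z p [n] (of_bool (n \<in> A))" ..
    from eventually_conj[OF beval_complete[OF this] eventually_ge_at_top[of t]]
    obtain l where "beval Z l p [n] = Suc (of_bool (n \<in> A))" "t \<le> l"
      unfolding eventually_sequentially by blast
    then show False using n[of Z l] Z by simp
  qed
  with T show ?thesis by blast
qed

section \<open>The limit of the stages\<close>

theorem theorem3p7:
  fixes A X :: "nat set"
  assumes "\<And>\<epsilon>::real. \<epsilon> > 0 \<Longrightarrow>
    \<exists>D. upper_density (sym_diff X D) \<le> ereal \<epsilon> \<and> \<not> A \<le>\<^sub>T D"
  shows "\<exists>D. coarse_description D X \<and> \<not> A \<le>\<^sub>T D"
proof -
  have close: "\<exists>D. (\<forall>\<^sub>F m in sequentially. K * disagreements X D m \<le> m) \<and> \<not> A \<le>\<^sub>T D" if "K > 0" for K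
    using assms[of "1 / (2 * real K)"] eventually_disagreements_le[OF _ that] that by auto
  define step :: "nat \<Rightarrow> nat set \<times> nat \<Rightarrow> nat set \<times> nat \<Rightarrow> bool" where
    "step i = (\<lambda>(S, s) (T, t). s < t \<and> close_extension (4 ^ i) X S s T t \<and>
      (\<forall>Z. (\<forall>u\<ge>t. close_extension (4 ^ Suc i) X T t Z u) \<longrightarrow>
        \<not> (\<forall>n. oeval Z (from_nat i) [n] (of_bool (n \<in> A)))))" for i
  define ok :: "nat \<Rightarrow> nat set \<times> nat \<Rightarrow> bool" where
    "ok i = (\<lambda>(S, s). 4 ^ i * disagreements S X s \<le> s)" for i
  have "\<exists>f. \<forall>i. ok i (f i) \<and> step i (f i) (f (Suc i))"
  proof (rule dependent_nat_choice)
    \<comment> \<open>Length 0 makes this the empty string; the set \<open>X\<close> is a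
      placeholder.\<close>
    show "\<exists>x. ok 0 x" by (intro exI[of _ "(X, 0)"]) (simp add: ok_def disagreements_def)
    show "\<exists>y. ok (Suc i) y \<and> step i x y" if "ok i x" for x i
    proof -
      obtain S s where x: "x = (S, s)" by (cases x)
      obtain D where D: "\<forall>\<^sub>F m in sequentially. 4 * 4 ^ i * disagreements X D m \<le> m" "\<not> A \<le>\<^sub>T D"
        using close[of "4 * 4 ^ i"] by auto
      have "4 ^ i * disagreements S X s \<le> s" using that x by (simp add: ok_def)
      from diagonalization_step[OF this D, of "from_nat i"]
      obtain T t where "step i x (T, t)" "ok (Suc i) (T, t)"
        by (auto simp: ok_def step_def x)
      then show ?thesis by blast
    qed
  qed
  then obtain f where f: "\<And>i. step i (f i) (f (Suc i))" by blast
  define S where "S i = fst (f i)" for i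
  define s where "s i = snd (f i)" for i
  have fSs: "f i = (S i, s i)" for i by (simp add: S_def s_def)
  have s_less: "s i < s (Suc i)" for i
    using f[of i] by (simp add: step_def fSs)
  then have s_mono: "strict_mono s" by (simp add: strict_mono_Suc_iff)
  have agree_Suc: "S (Suc i) \<inter> {..<s i} = S i \<inter> {..<s i}" for i
    using f[of i] by (simp add: step_def fSs close_extension_def)
  have agree: "k \<in> S j \<longleftrightarrow> k \<in> S i" if "i \<le> j" "k < s i" for i j k
    using that(1)
  proof (induction j rule: dec_induct)
    case (step j)
    have "k < s j"
      using that(2) step.hyps(1) strict_mono_less_eq[OF s_mono, of i j] by simp
    then show ?case using step.IH agree_Suc[of j] by blast
  qed simp
  \<comment> \<open>Since \<open>k < s (Suc k)\<close>, bit \<open>k\<close> is settled by stage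
    \<open>Suc k\<close>.\<close>
  define D where "D = {k. k \<in> S (Suc k)}"
  have D: "D \<inter> {..<s i} = S i \<inter> {..<s i}" for i
  proof -
    have "k \<in> D \<longleftrightarrow> k \<in> S i" if "k < s i" for k
    proof -
      have "k < s (Suc k)" using strict_mono_imp_increasing[OF s_mono, of "Suc k"] by simp
      then show ?thesis
        using agree[of i "Suc k" k] agree[of "Suc k" i k] that by (cases "i \<le> Suc k") (auto simp: D_def)
    qed
    then show ?thesis by auto
  qed
  have bound: "4 ^ i * disagreements D X m \<le> m" if "s i \<le> m" for i m
  proof -
    \<comment> \<open>Stage \<open>j\<close> controls the lengths from \<open>s j\<close> to
      \<open>s (Suc j)\<close>, and its bound is at least as sharp as that of stage
      \<open>i\<close>.\<close>
    have "\<exists>j\<ge>i. s j \<le> m \<and> m \<le> s (Suc j)"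
    proof -
      have "\<exists>l. m < s l" using strict_mono_imp_increasing[OF s_mono, of "Suc m"] by (auto simp: Suc_le_eq)
      define l where "l = (LEAST l. m < s l)"
      have l: "m < s l" unfolding l_def using \<open>\<exists>l. m < s l\<close> by (rule LeastI_ex)
      have "i < l" using l that strict_mono_less[OF s_mono, of i l] by linarith
      then obtain j where j: "l = Suc j" "i \<le> j" by (cases l) auto
      have "\<not> m < s j" using not_less_Least[of j "\<lambda>l. m < s l"] j(1) by (simp add: l_def)
      then show ?thesis using l j by (intro exI[of _ j]) simp
    qed
    then obtain j where j: "i \<le> j" "s j \<le> m" "m \<le> s (Suc j)" by blast
    have "4 ^ i * disagreements D X m \<le> 4 ^ j * disagreements D X m"
      using j(1) by (intro mult_right_mono power_increasing) auto
    also have "\<dots> = 4 ^ j * disagreements (S (Suc j)) X m"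
      using disagreements_cong[OF D j(3)] by simp
    also have "\<dots> \<le> m" using f[of j] j by (simp add: step_def fSs close_extension_def)
    finally show ?thesis .
  qed
  have "coarse_description D X"
    unfolding coarse_description_def has_density_def
  proof (rule LIMSEQ_I)
    fix e :: real assume "e > 0"
    then obtain i where i: "(1 / 4) ^ i < e" using real_arch_pow_inv[of e "1 / 4"] by auto
    have "norm (partial_density m (sym_diff D X) - 0) < e" if m: "s i \<le> m" for m
    proof -
      have "real (4 ^ i * disagreements D X m) \<le> real m" using bound[OF m] by (rule of_nat_mono)
      then have "real (disagreements D X m) / real m \<le> (1 / 4) ^ i"
        by (cases "m = 0") (simp_all add: field_simps)
      then show ?thesis using i by (simp add: partial_density_sym_diff)
    qed
    then show "\<exists>no. \<forall>m\<ge>no. norm (partial_density m (sym_diff D X) - 0) < e" by blast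
  qed
  moreover have "\<not> A \<le>\<^sub>T D"
  proof
    assume "A \<le>\<^sub>T D"
    then obtain p where p: "\<forall>n. oeval D p [n] (of_bool (n \<in> A))"
      unfolding turing_reducible_def by blast
    define i where "i = to_nat p"
    \<comment> \<open>The limit \<open>D\<close> is itself an admissible continuation of what stage
      \<open>i\<close> produced, so that stage defeats the program coded by
      \<open>i\<close>.\<close>
    have "close_extension (4 ^ Suc i) X (S (Suc i)) (s (Suc i)) D u" if "u \<ge> s (Suc i)" for u
      using that D[of "Suc i"] bound[of "Suc i"] unfolding close_extension_def by auto
    then have "\<not> (\<forall>n. oeval D (from_nat i) [n] (of_bool (n \<in> A)))"
      using f[of i] unfolding step_def fSs split by blast
    with p show False by (simp add: i_def)
  qed
  ultimately show ?thesis by blast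
qed

end
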